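(* Let $(A,\mu)\in\mathcal C$ and let $\mathfrak N$ be a Nijenhuis operator for $A$. Define new products on $A$ by setting, for all $a,a'\in A$, $$a\succ a':=\mathfrak N(a)a',\quad a\prec a':=a\mathfrak N(a'),\quad a\vee a':=-\mathfrak N(aa').$$ Then $(A,\prec,\succ,\vee)$ is a $\mathcal C$-NS-algebra.
   Context: Fix a commutative ring $R$; all modules, tensor products and linear maps are over $R$. An algebra $(A,\mu_1,\dots,\mu_s)$ is an $R$-module $A$ with linear maps (products) $\mu_i:A\otimes A\to A$; no associativity or unit is assumed. For a single product write $ab=\mu(a\otimes b)$. Fix a collection of multilinear relations $\mathcal R_1=0,\dots,\mathcal R_k=0$ in one binary product: an $n$-linear relation is an $R$-linear combination of parenthesized (non-associative) monomials in $x_1,\dots,x_n$, each variable occurring exactly once in each monomial. $\mathcal C$ is the category of all algebras $(A,\mu)$ in which these relations hold for all substitutions of elements of $A$; $(A,\mu)\in\mathcal C$ means that $(A,\mu)$ satisfies all of them. Nijenhuis operator for $(A,\mu)\in\mathcal C$: a linear map $\mathfrak N:A\to A$ such that $\mathfrak N(a)\mathfrak N(a')=\mathfrak N\big(\mathfrak N(a)a'+a\mathfrak N(a')-\mathfrak N(aa')\big)$ for all $a,a'\in A$. $\mathcal C$-NS-algebra: an algebra $(A,\prec,\succ,\vee)$ with three products such that $(A\oplus A,\boxtimes)\in\mathcal C$, where $(a,x)\boxtimes(a',x'):=(a\star a',\,a\succ x'+x\prec a')$ and $a\star a':=a\succ a'+a\prec a'+a\vee a'$. *)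

theory Defs
  imports "HOL-Analysis.Product_Vector" "HOL-Library.Poly_Mapping"
begin

definition bilinear_product ::
    "('r::comm_ring_1 \<Rightarrow> 'a::ab_group_add \<Rightarrow> 'a) \<Rightarrow> ('a \<Rightarrow> 'a \<Rightarrow> 'a) \<Rightarrow> bool"
  where "bilinear_product s \<mu> \<longleftrightarrow>
    (\<forall>a. module_hom s s (\<lambda>b. \<mu> a b)) \<and> (\<forall>b. module_hom s s (\<lambda>a. \<mu> a b))"

text \<open>
  An algebra is an \<open>R\<close>-module with any number of products; a linear map on \<open>A \<otimes> A\<close> is given
  as an \<open>R\<close>-bilinear map. Neither associativity nor a unit is assumed. The module structure is
  given by the scalar multiplication \<open>s\<close>, with \<open>R\<close> and \<open>A\<close> being whole types, as in
  \<^theory>\<open>HOL.Modules\<close>.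
\<close>

definition nonassoc_algebra ::
    "('r::comm_ring_1 \<Rightarrow> 'a::ab_group_add \<Rightarrow> 'a) \<Rightarrow> ('a \<Rightarrow> 'a \<Rightarrow> 'a) list \<Rightarrow> bool"
  where "nonassoc_algebra s \<mu>s \<longleftrightarrow> module s \<and> (\<forall>\<mu>\<in>set \<mu>s. bilinear_product s \<mu>)"

text \<open>Parenthesized monomials; \<open>Var i\<close> stands for the variable \<open>x\<^sub>i\<close>.\<close>

datatype monomial = Var nat | Mul monomial monomial

primrec monomial_vars :: "monomial \<Rightarrow> nat list" where
  "monomial_vars (Var i) = [i]"
| "monomial_vars (Mul p q) = monomial_vars p @ monomial_vars q"

primrec eval_monomial :: "('a \<Rightarrow> 'a \<Rightarrow> 'a) \<Rightarrow> (nat \<Rightarrow> 'a) \<Rightarrow> monomial \<Rightarrow> 'a" where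
  "eval_monomial \<mu> x (Var i) = x i"
| "eval_monomial \<mu> x (Mul p q) = \<mu> (eval_monomial \<mu> x p) (eval_monomial \<mu> x q)"

text \<open>
  The left-hand side of a relation is a formal \<open>R\<close>-linear combination of monomials, that is, an
  element of the free \<open>R\<close>-module \<^typ>\<open>monomial \<Rightarrow>\<^sub>0 'r::comm_ring_1\<close>.
\<close>

definition multilinear_relation :: "nat \<Rightarrow> (monomial \<Rightarrow>\<^sub>0 'r::comm_ring_1) \<Rightarrow> bool"
  where "multilinear_relation n P \<longleftrightarrow>
    (\<forall>m\<in>Poly_Mapping.keys P. distinct (monomial_vars m) \<and> set (monomial_vars m) = {1..n})"

definition eval_relation ::
    "('r::comm_ring_1 \<Rightarrow> 'a::ab_group_add \<Rightarrow> 'a) \<Rightarrow> ('a \<Rightarrow> 'a \<Rightarrow> 'a) \<Rightarrow> (nat \<Rightarrow> 'a) \<Rightarrow>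
      (monomial \<Rightarrow>\<^sub>0 'r) \<Rightarrow> 'a"
  where "eval_relation s \<mu> x P =
    (\<Sum>m\<in>Poly_Mapping.keys P. s (Poly_Mapping.lookup P m) (eval_monomial \<mu> x m))"

text \<open>Membership of \<open>(A, \<mu>)\<close> in the category \<open>\<C>\<close> determined by the relations \<open>Rs\<close>.\<close>

definition in_category ::
    "(monomial \<Rightarrow>\<^sub>0 'r::comm_ring_1) list \<Rightarrow> ('r \<Rightarrow> 'a::ab_group_add \<Rightarrow> 'a) \<Rightarrow>
      ('a \<Rightarrow> 'a \<Rightarrow> 'a) \<Rightarrow> bool"
  where "in_category Rs s \<mu> \<longleftrightarrow>
    nonassoc_algebra s [\<mu>] \<and> (\<forall>P\<in>set Rs. \<forall>x. eval_relation s \<mu> x P = 0)"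

definition nijenhuis_operator ::
    "('r::comm_ring_1 \<Rightarrow> 'a::ab_group_add \<Rightarrow> 'a) \<Rightarrow> ('a \<Rightarrow> 'a \<Rightarrow> 'a) \<Rightarrow> ('a \<Rightarrow> 'a) \<Rightarrow> bool"
  where "nijenhuis_operator s \<mu> N \<longleftrightarrow> module_hom s s N \<and>
    (\<forall>a a'. \<mu> (N a) (N a') = N (\<mu> (N a) a' + \<mu> a (N a') - N (\<mu> a a')))"

definition ns_star ::
    "('a::ab_group_add \<Rightarrow> 'a \<Rightarrow> 'a) \<Rightarrow> ('a \<Rightarrow> 'a \<Rightarrow> 'a) \<Rightarrow> ('a \<Rightarrow> 'a \<Rightarrow> 'a) \<Rightarrow> 'a \<Rightarrow> 'a \<Rightarrow> 'a"
  where "ns_star prec succ vee a a' = succ a a' + prec a a' + vee a a'"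

definition ns_box ::
    "('a::ab_group_add \<Rightarrow> 'a \<Rightarrow> 'a) \<Rightarrow> ('a \<Rightarrow> 'a \<Rightarrow> 'a) \<Rightarrow> ('a \<Rightarrow> 'a \<Rightarrow> 'a) \<Rightarrow>
      'a \<times> 'a \<Rightarrow> 'a \<times> 'a \<Rightarrow> 'a \<times> 'a"
  where "ns_box prec succ vee = (\<lambda>(a, x) (a', x').
    (ns_star prec succ vee a a', succ a x' + prec x a'))"

text \<open>\<open>module_prod.scale s s\<close> is the componentwise scalar multiplication on \<open>A \<oplus> A\<close>.\<close>

definition ns_algebra ::
    "(monomial \<Rightarrow>\<^sub>0 'r::comm_ring_1) list \<Rightarrow> ('r \<Rightarrow> 'a::ab_group_add \<Rightarrow> 'a) \<Rightarrow>
      ('a \<Rightarrow> 'a \<Rightarrow> 'a) \<Rightarrow> ('a \<Rightarrow> 'a \<Rightarrow> 'a) \<Rightarrow> ('a \<Rightarrow> 'a \<Rightarrow> 'a) \<Rightarrow> bool"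
  where "ns_algebra Rs s prec succ vee \<longleftrightarrow>
    nonassoc_algebra s [prec, succ, vee] \<and>
    in_category Rs (module_prod.scale s s) (ns_box prec succ vee)"

end

theory Submission
  imports Defs
begin

text \<open>
  Let \<open>a \<star> b = N(a) b + a N(b) - N(a b)\<close>. On polynomials \<open>A[u]\<close> with the product
  \<open>u \<mu> + \<star>\<close>, the Nijenhuis identity says exactly that \<open>u + N\<close> is a homomorphism to \<open>A[u]\<close>
  with the product \<open>\<mu>\<close> extended \<open>u\<close>-linearly. The latter algebra satisfies all multilinear
  relations of \<open>(A, \<mu>)\<close>, and \<open>u + N\<close> is injective, as one sees on leading coefficients. So the
  product \<open>u \<mu> + \<star>\<close> satisfies the relations, and setting \<open>u = 0\<close> yields them for \<open>\<star>\<close>, the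
  first component of \<open>\<boxtimes>\<close>. The second component of \<open>\<boxtimes>\<close> is handled by the homomorphism
  \<open>(a, x) \<mapsto> N(a) + u x\<close> from \<open>A \<oplus> A\<close> to \<open>A[u]/(u\<^sup>2)\<close>.
\<close>

text \<open>Monomials are built from the product alone, so a relation compatible with both products
  passes to them. With \<open>R\<close> the graph of a map this transports homomorphisms; with
  \<open>R\<close> blind to one side it proves an invariant.\<close>

lemma eval_monomial_rel:
  assumes "\<And>i. R (x i) (y i)"
    and "\<And>a b a' b'. R a b \<Longrightarrow> R a' b' \<Longrightarrow> R (\<mu> a a') (\<nu> b b')"
  shows "R (eval_monomial \<mu> x m) (eval_monomial \<nu> y m)"
  by (induction m) (simp_all add: assms)

lemma eval_monomial_cong:
  assumes "\<And>i. i \<in> set (monomial_vars m) \<Longrightarrow> x i = y i"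
  shows "eval_monomial \<mu> x m = eval_monomial \<mu> y m"
  using assms by (induction m) auto

lemma module_hom_eval_relation:
  assumes "module_hom s t h" "\<And>a b. h (\<mu> a b) = \<nu> (h a) (h b)"
  shows "h (eval_relation s \<mu> x P) = eval_relation t \<nu> (\<lambda>i. h (x i)) P"
proof -
  interpret module_hom s t h by fact
  have "h (eval_monomial \<mu> x m) = eval_monomial \<nu> (\<lambda>i. h (x i)) m" for m
    by (rule eval_monomial_rel[where R = "\<lambda>a b. h a = b"]) (simp_all add: assms(2))
  then show ?thesis by (simp add: eval_relation_def sum scale)
qed

section \<open>Polynomials with coefficients in an algebra\<close>

text \<open>
  A polynomial or power series in \<open>u\<close> over \<open>A\<close> is represented by its sequence of coefficients.
\<close>

definition cauchy_product ::
    "('a \<Rightarrow> 'a \<Rightarrow> 'a::comm_monoid_add) \<Rightarrow> (nat \<Rightarrow> 'a) \<Rightarrow> (nat \<Rightarrow> 'a) \<Rightarrow> nat \<Rightarrow> 'a"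
  where "cauchy_product \<mu> f g k = (\<Sum>i\<le>k. \<mu> (f i) (g (k - i)))"

text \<open>Multiplication by \<open>u\<close>.\<close>

definition shift :: "(nat \<Rightarrow> 'a) \<Rightarrow> nat \<Rightarrow> 'a::zero"
  where "shift f k = (case k of 0 \<Rightarrow> 0 | Suc j \<Rightarrow> f j)"

lemma shift_0 [simp]: "shift f 0 = 0"
  and shift_Suc [simp]: "shift f (Suc k) = f k"
  by (simp_all add: shift_def)

text \<open>The polynomial \<open>a + u b\<close>.\<close>

definition linear_poly :: "'a \<Rightarrow> 'a \<Rightarrow> nat \<Rightarrow> 'a::zero"
  where "linear_poly a b k = (if k = 0 then a else if k = 1 then b else 0)"

locale algebra_product = module s
  for s :: "'r::comm_ring_1 \<Rightarrow> 'a::ab_group_add \<Rightarrow> 'a" +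
  fixes \<mu> :: "'a \<Rightarrow> 'a \<Rightarrow> 'a"
  assumes bilinear: "bilinear_product s \<mu>"
begin

lemma hom_right: "module_hom s s (\<lambda>b. \<mu> a b)"
  and hom_left: "module_hom s s (\<lambda>a. \<mu> a b)"
  using bilinear by (simp_all add: bilinear_product_def)

lemmas product_simps =
  module_hom.add[OF hom_right] module_hom.add[OF hom_left]
  module_hom.scale[OF hom_right] module_hom.scale[OF hom_left]
  module_hom.zero[OF hom_right] module_hom.zero[OF hom_left]

lemmas product_sum_right = module_hom.sum[OF hom_right]
lemmas product_sum_left = module_hom.sum[OF hom_left]

lemma cauchy_product_add_left:
  "cauchy_product \<mu> (\<lambda>i. f i + f' i) g k = cauchy_product \<mu> f g k + cauchy_product \<mu> f' g k"
  by (simp add: cauchy_product_def product_simps sum.distrib)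

lemma cauchy_product_add_right:
  "cauchy_product \<mu> f (\<lambda>i. g i + g' i) k = cauchy_product \<mu> f g k + cauchy_product \<mu> f g' k"
  by (simp add: cauchy_product_def product_simps sum.distrib)

lemma cauchy_product_shift_left:
  "cauchy_product \<mu> (shift f) g k = shift (cauchy_product \<mu> f g) k"
  by (cases k) (simp_all add: cauchy_product_def product_simps sum.atMost_Suc_shift
      del: sum.atMost_Suc)

lemma cauchy_product_shift_right:
  "cauchy_product \<mu> f (shift g) k = shift (cauchy_product \<mu> f g) k"
  by (cases k) (simp_all add: cauchy_product_def product_simps Suc_diff_le)

lemma cauchy_product_eq_0:
  assumes "\<And>i. i > d \<Longrightarrow> f i = 0" "\<And>i. i > e \<Longrightarrow> g i = 0" "k > d + e"
  shows "cauchy_product \<mu> f g k = 0"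
  unfolding cauchy_product_def
proof (rule sum.neutral, rule ballI)
  fix i
  assume "i \<in> {..k}"
  then have "i > d \<or> k - i > e" using assms(3) by auto
  then show "\<mu> (f i) (g (k - i)) = 0" using assms(1,2) by (auto simp: product_simps)
qed

text \<open>Multiply out: since no variable repeats, choosing \<open>a i\<close> or
  \<open>u b i\<close> at every leaf amounts to choosing the set \<open>S\<close> of variables that
  take \<open>b i\<close>, and this choice contributes to the power of \<open>u\<close> with
  exponent \<open>card S\<close>.\<close>

lemma eval_monomial_linear_poly:
  assumes "distinct (monomial_vars m)"
  shows "eval_monomial (cauchy_product \<mu>) (\<lambda>i. linear_poly (a i) (b i)) m k =
    (\<Sum>S | S \<subseteq> set (monomial_vars m) \<and> card S = k.
      eval_monomial \<mu> (\<lambda>i. if i \<in> S then b i else a i) m)"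
  using assms
proof (induction m arbitrary: k)
  case (Var j)
  have "{S. S \<subseteq> {j} \<and> card S = k} = (if k = 0 then {{}} else if k = 1 then {{j}} else {})"
    by (auto simp: subset_singleton_iff)
  then show ?case by (simp add: linear_poly_def)
next
  case (Mul p q)
  let ?V = "set (monomial_vars p)" and ?W = "set (monomial_vars q)"
  let ?E = "\<lambda>m S. eval_monomial \<mu> (\<lambda>i. if i \<in> S then b i else a i) m"
  let ?C = "\<lambda>V k. {S. S \<subseteq> V \<and> card S = k}"
  have disj: "?V \<inter> ?W = {}" using Mul.prems by auto
  have fin: "finite (?C V k)" if "finite V" for V :: "nat set" and k
    using that by simp
  have E: "\<mu> (?E p S) (?E q T) = ?E (Mul p q) (S \<union> T)" if "S \<subseteq> ?V" "T \<subseteq> ?W" for S T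
  proof -
    have "?E p S = ?E p (S \<union> T)" "?E q T = ?E q (S \<union> T)"
      using that disj by (auto intro!: eval_monomial_cong)
    then show ?thesis by simp
  qed
  have "eval_monomial (cauchy_product \<mu>) (\<lambda>i. linear_poly (a i) (b i)) (Mul p q) k =
      (\<Sum>i\<le>k. \<mu> (\<Sum>S\<in>?C ?V i. ?E p S) (\<Sum>T\<in>?C ?W (k - i). ?E q T))"
    unfolding eval_monomial.simps cauchy_product_def[of \<mu> "eval_monomial (cauchy_product \<mu>) x p" for x]
    using Mul by simp
  also have "\<dots> = (\<Sum>i\<le>k. \<Sum>(S, T)\<in>?C ?V i \<times> ?C ?W (k - i). \<mu> (?E p S) (?E q T))"
    by (simp add: product_sum_right product_sum_left sum.cartesian_product[symmetric]
        sum.swap[of _ "?C ?W _" "?C ?V _"])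
  also have "\<dots> = (\<Sum>(i, S, T)\<in>(SIGMA i:{..k}. ?C ?V i \<times> ?C ?W (k - i)). \<mu> (?E p S) (?E q T))"
    by (subst sum.Sigma) (auto simp: fin)
  also have "\<dots> = (\<Sum>S\<in>?C (?V \<union> ?W) k. ?E (Mul p q) S)"
  \<comment> \<open>A subset of a disjoint union is determined by its traces on the two parts, whose
    sizes add up to \<open>k\<close>; the index \<open>i\<close> is the size of the first
    trace.\<close>
  proof (rule sum.reindex_bij_witness[where j = "\<lambda>(i, S, T). S \<union> T" and
        i = "\<lambda>S. (card (S \<inter> ?V), S \<inter> ?V, S \<inter> ?W)"], goal_cases)
    case (1 z)
    then obtain i S T where z: "z = (i, S, T)" "S \<subseteq> ?V" "card S = i" "T \<subseteq> ?W" by auto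
    then have "(S \<union> T) \<inter> ?V = S" "(S \<union> T) \<inter> ?W = T"
      using disj by auto
    then show ?case using z by simp
  next
    case (2 z)
    then obtain i S T where z: "z = (i, S, T)" "i \<le> k" "S \<subseteq> ?V" "card S = i" "T \<subseteq> ?W"
        "card T = k - i"
      by auto
    have "card (S \<union> T) = card S + card T"
      using z disj by (intro card_Un_disjoint) (auto dest: finite_subset)
    moreover have "(S \<union> T) \<inter> ?V = S" "(S \<union> T) \<inter> ?W = T"
      using z disj by auto
    ultimately show ?case using z by auto
  next
    case (3 S)
    then show ?case by auto
  next
    case (4 S)
    have "card S = card (S \<inter> ?V) + card (S \<inter> ?W)"
      using 4 disj by (subst card_Un_disjoint[symmetric])
        (auto simp flip: Int_Un_distrib simp: Int_absorb2)
    then show ?case using 4 by auto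
  next
    case (5 z)
    then show ?case using E by auto
  qed
  finally show ?case by simp
qed

text \<open>All monomials of \<open>P\<close> have the same variables, so the same sets
  \<open>S\<close> index all their expansions. Exchanging the sums leaves one instance of the
  relation in \<open>A\<close> for each \<open>S\<close>.\<close>

lemma relation_linear_poly:
  assumes P: "multilinear_relation n P" and vanish: "\<And>x. eval_relation s \<mu> x P = 0"
  shows "(\<Sum>m\<in>Poly_Mapping.keys P. s (Poly_Mapping.lookup P m)
    (eval_monomial (cauchy_product \<mu>) (\<lambda>i. linear_poly (a i) (b i)) m k)) = 0"
    (is "?lhs = 0")
proof -
  let ?x = "\<lambda>S i. if i \<in> S then b i else a i"
  have "?lhs = (\<Sum>m\<in>Poly_Mapping.keys P. \<Sum>S | S \<subseteq> {1..n} \<and> card S = k.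
      s (Poly_Mapping.lookup P m) (eval_monomial \<mu> (?x S) m))"
    using P by (intro sum.cong)
      (simp_all add: multilinear_relation_def eval_monomial_linear_poly scale_sum_right)
  also have "\<dots> = (\<Sum>S | S \<subseteq> {1..n} \<and> card S = k. eval_relation s \<mu> (?x S) P)"
    by (subst sum.swap) (simp add: eval_relation_def)
  finally show ?thesis by (simp add: vanish)
qed

end

section \<open>The deformed product\<close>

locale nijenhuis = algebra_product +
  fixes N :: "'b \<Rightarrow> 'b"
  assumes nijenhuis: "nijenhuis_operator s \<mu> N"
begin

abbreviation "prec a a' \<equiv> \<mu> a (N a')"
abbreviation "succ a a' \<equiv> \<mu> (N a) a'"
abbreviation "vee a a' \<equiv> - N (\<mu> a a')"
abbreviation "star \<equiv> ns_star prec succ vee"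
abbreviation "box \<equiv> ns_box prec succ vee"

sublocale N: module_hom s s N
  using nijenhuis by (simp add: nijenhuis_operator_def)

lemma N_star: "N (star a b) = \<mu> (N a) (N b)"
  using nijenhuis by (simp add: nijenhuis_operator_def ns_star_def)

definition deformed_product :: "(nat \<Rightarrow> 'b) \<Rightarrow> (nat \<Rightarrow> 'b) \<Rightarrow> nat \<Rightarrow> 'b"
  where "deformed_product f g k = cauchy_product star f g k + shift (cauchy_product \<mu> f g) k"

definition u_plus_N :: "(nat \<Rightarrow> 'b) \<Rightarrow> nat \<Rightarrow> 'b"
  where "u_plus_N f k = N (f k) + shift f k"

lemma cauchy_product_star:
  "cauchy_product star f g k = cauchy_product \<mu> (\<lambda>i. N (f i)) g k
    + cauchy_product \<mu> f (\<lambda>i. N (g i)) k - N (cauchy_product \<mu> f g k)"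
  by (simp add: cauchy_product_def ns_star_def sum.distrib sum_subtractf N.sum)

lemma N_cauchy_product_star:
  "N (cauchy_product star f g k) = cauchy_product \<mu> (\<lambda>i. N (f i)) (\<lambda>i. N (g i)) k"
  by (simp add: cauchy_product_def N.sum N_star)

text \<open>Compare powers of \<open>u\<close>, treating \<open>f\<close> and \<open>g\<close> as
  constants: the constant term is \<open>N_star\<close>, the coefficient of \<open>u\<close> is the
  definition of \<open>star\<close> solved for \<open>star + N \<mu>\<close>, and the coefficient of
  the square of \<open>u\<close> is \<open>\<mu>\<close> on both sides.\<close>

lemma u_plus_N_deformed_product:
  "u_plus_N (deformed_product f g) = cauchy_product \<mu> (u_plus_N f) (u_plus_N g)"
proof
  fix k
  let ?c = "cauchy_product \<mu>" and ?Nf = "\<lambda>i. N (f i)" and ?Ng = "\<lambda>i. N (g i)"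
  have "?c (u_plus_N f) (u_plus_N g) k = ?c ?Nf ?Ng k + shift (?c ?Nf g) k +
      (shift (?c f ?Ng) k + shift (shift (?c f g)) k)"
    by (cases k) (simp_all add: u_plus_N_def[abs_def] cauchy_product_add_left
        cauchy_product_add_right cauchy_product_shift_left cauchy_product_shift_right)
  also have "\<dots> = u_plus_N (deformed_product f g) k"
    by (cases k; simp add: u_plus_N_def deformed_product_def N.add N_cauchy_product_star)
      (simp add: cauchy_product_star)
  finally show "u_plus_N (deformed_product f g) k = ?c (u_plus_N f) (u_plus_N g) k" ..
qed

section \<open>Bilinearity of the products\<close>

lemma bilinear_prec: "bilinear_product s prec"
  and bilinear_succ: "bilinear_product s succ"
  and bilinear_vee: "bilinear_product s vee"
  unfolding bilinear_product_def
  by (auto intro!: module_hom.intro module_axioms module_hom_axioms.intro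
      simp: N.add N.scale product_simps)

lemma bilinear_star: "bilinear_product s star"
  unfolding bilinear_product_def ns_star_def
  by (auto intro!: module_hom.intro module_axioms module_hom_axioms.intro
      simp: N.add N.scale product_simps scale_right_distrib scale_right_diff_distrib)

sublocale star: algebra_product s star
  by unfold_locales (rule bilinear_star)

sublocale prod: module_prod s s
  by unfold_locales

lemma bilinear_box: "bilinear_product prod.scale box"
  unfolding bilinear_product_def
  by (auto intro!: module_hom.intro prod.p.module_axioms module_hom_axioms.intro
      simp: ns_box_def prod.scale_def star.product_simps N.add N.scale product_simps
        scale_right_distrib)

section \<open>The relations for \<open>star\<close>\<close>

lemma eval_monomial_deformed_product_0:
  "eval_monomial deformed_product (\<lambda>i. linear_poly (a i) 0) m 0 = eval_monomial star a m"
  by (rule eval_monomial_rel[where R = "\<lambda>f a. f 0 = a"])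
    (simp_all add: linear_poly_def deformed_product_def cauchy_product_def)

lemma eval_monomial_deformed_product_finite_degree:
  "\<exists>d. \<forall>k>d. eval_monomial deformed_product (\<lambda>i. linear_poly (a i) 0) m k = 0"
\<comment> \<open>The second argument of \<open>R\<close> is ignored, so this is an induction on the
  invariant of having finite degree.\<close>
proof (rule eval_monomial_rel[where R = "\<lambda>f _. \<exists>d. \<forall>k>d. f k = 0"])
  show "\<exists>d. \<forall>k>d. linear_poly (a i) 0 k = 0" for i
    by (auto simp: linear_poly_def)
next
  fix f g :: "nat \<Rightarrow> 'b"
  assume "\<exists>d. \<forall>k>d. f k = 0" "\<exists>d. \<forall>k>d. g k = 0"
  then obtain d e where f: "\<And>i. i > d \<Longrightarrow> f i = 0" and g: "\<And>i. i > e \<Longrightarrow> g i = 0" by blast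
  \<comment> \<open>The extra \<open>Suc\<close> pays for the factor \<open>u\<close> in front of
    \<open>\<mu>\<close>.\<close>
  have "deformed_product f g k = 0" if "k > Suc (d + e)" for k
    using that cauchy_product_eq_0[OF f g] star.cauchy_product_eq_0[OF f g]
    by (cases k) (simp_all add: deformed_product_def)
  then show "\<exists>d. \<forall>k>d. deformed_product f g k = 0" by blast
qed

lemma u_plus_N_eval_monomial:
  "u_plus_N (eval_monomial deformed_product (\<lambda>i. linear_poly (a i) 0) m) =
    eval_monomial (cauchy_product \<mu>) (\<lambda>i. linear_poly (N (a i)) (a i)) m"
proof (rule eval_monomial_rel[where R = "\<lambda>f g. u_plus_N f = g"])
  show "u_plus_N (linear_poly (a i) 0) = linear_poly (N (a i)) (a i)" for i
    by (rule ext) (simp add: u_plus_N_def linear_poly_def shift_def split: nat.split)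
qed (simp add: u_plus_N_deformed_product)

text \<open>The coefficient at \<open>Suc k\<close> reads \<open>N (f (Suc k)) + f k = 0\<close>, so
  vanishing descends from above the degree bound to the constant term.\<close>

lemma u_plus_N_injective:
  assumes "u_plus_N f = (\<lambda>_. 0)" "\<forall>k>d. f k = 0"
  shows "f 0 = 0"
proof -
  have "f k = 0" if "f (Suc k) = 0" for k
    using fun_cong[OF assms(1), of "Suc k"] that by (simp add: u_plus_N_def)
  moreover have "f (Suc d) = 0" using assms(2) by simp
  ultimately show ?thesis by (induction d) auto
qed

lemma star_relation:
  assumes "multilinear_relation n P" "\<And>x. eval_relation s \<mu> x P = 0"
  shows "eval_relation s star x P = 0"
proof -
  let ?F = "eval_monomial deformed_product (\<lambda>i. linear_poly (x i) 0)"
  \<comment> \<open>\<open>Z\<close> is the value of the relation at the constants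
    \<open>x i\<close> in the deformed polynomial algebra; its constant term is the value under
    \<open>star\<close>.\<close>
  define Z where "Z k = (\<Sum>m\<in>Poly_Mapping.keys P. s (Poly_Mapping.lookup P m) (?F m k))" for k
  have "u_plus_N Z k = (\<Sum>m\<in>Poly_Mapping.keys P. s (Poly_Mapping.lookup P m) (u_plus_N (?F m) k))"
    for k
    by (cases k) (simp_all add: u_plus_N_def Z_def N.sum N.scale scale_right_distrib sum.distrib)
  then have "u_plus_N Z = (\<lambda>_. 0)"
    using relation_linear_poly[OF assms] by (auto simp: u_plus_N_eval_monomial)
  moreover obtain d where d: "\<And>m k. k > d m \<Longrightarrow> ?F m k = 0"
    using eval_monomial_deformed_product_finite_degree by metis
  \<comment> \<open>The sum of the degree bounds dominates each of them and so serves as a common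
    bound.\<close>
  have "\<forall>k>\<Sum>m\<in>Poly_Mapping.keys P. d m. Z k = 0"
  proof (intro allI impI)
    fix k
    assume "k > (\<Sum>m\<in>Poly_Mapping.keys P. d m)"
    then have "k > d m" if "m \<in> Poly_Mapping.keys P" for m
      using member_le_sum[OF that, of d] by simp
    then show "Z k = 0" unfolding Z_def by (intro sum.neutral) (simp add: d)
  qed
  ultimately have "Z 0 = 0" by (rule u_plus_N_injective)
  then show ?thesis
    by (simp add: Z_def eval_monomial_deformed_product_0 eval_relation_def)
qed

section \<open>The relations for \<open>box\<close>\<close>

lemma eval_monomial_box_cauchy_product:
  fixes z :: "nat \<Rightarrow> 'b \<times> 'b"
  defines "f \<equiv> eval_monomial (cauchy_product \<mu>) (\<lambda>i. linear_poly (N (fst (z i))) (snd (z i)))"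
  shows "N (fst (eval_monomial box z m)) = f m 0 \<and> snd (eval_monomial box z m) = f m 1"
  unfolding f_def
  \<comment> \<open>Only the coefficients at 0 and 1 are compared, which is the reduction modulo the
    square of \<open>u\<close>.\<close>
  by (rule eval_monomial_rel[where R = "\<lambda>w g. N (fst w) = g 0 \<and> snd w = g 1"])
    (auto simp: linear_poly_def cauchy_product_def ns_box_def N_star add.commute)

text \<open>The map to truncated polynomials only controls \<open>N\<close> of the first component,
  so that component goes through \<open>star_relation\<close> instead.\<close>

lemma box_relation:
  assumes "multilinear_relation n P" "\<And>x. eval_relation s \<mu> x P = 0"
  shows "eval_relation prod.scale box z P = 0"
proof (rule prod_eqI)
  have "fst (eval_relation prod.scale box z P) = eval_relation s star (\<lambda>i. fst (z i)) P"
    by (rule module_hom_eval_relation[OF prod.module_hom_fst]) (simp add: ns_box_def split_beta)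
  then show "fst (eval_relation prod.scale box z P) = fst 0"
    by (simp add: star_relation[OF assms])
  have "snd (eval_relation prod.scale box z P) = (\<Sum>m\<in>Poly_Mapping.keys P.
      s (Poly_Mapping.lookup P m) (snd (eval_monomial box z m)))"
    unfolding eval_relation_def
    by (simp add: module_hom.sum[OF prod.module_hom_snd] prod.scale_def)
  then show "snd (eval_relation prod.scale box z P) = snd 0"
    \<comment> \<open>The second component is the coefficient of \<open>u\<close>, so the case
      \<open>k = 1\<close> of \<open>relation_linear_poly\<close> applies.\<close>
    by (simp add: eval_monomial_box_cauchy_product relation_linear_poly[OF assms])
qed

end

theorem proposition4p6:
  fixes Rs :: "(monomial \<Rightarrow>\<^sub>0 'r::comm_ring_1) list"
    and s :: "'r \<Rightarrow> 'a::ab_group_add \<Rightarrow> 'a"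
    and \<mu> :: "'a \<Rightarrow> 'a \<Rightarrow> 'a"
    and N :: "'a \<Rightarrow> 'a"
  assumes "\<forall>P\<in>set Rs. \<exists>n. multilinear_relation n P"
    and "in_category Rs s \<mu>"
    and "nijenhuis_operator s \<mu> N"
  shows "ns_algebra Rs s
    (\<lambda>a a'. \<mu> a (N a'))
    (\<lambda>a a'. \<mu> (N a) a')
    (\<lambda>a a'. - N (\<mu> a a'))"
proof -
  have \<mu>: "module s" "bilinear_product s \<mu>" "\<And>P x. P \<in> set Rs \<Longrightarrow> eval_relation s \<mu> x P = 0"
    using assms(2) by (simp_all add: in_category_def nonassoc_algebra_def)
  interpret nijenhuis s \<mu> N
    by (intro nijenhuis.intro algebra_product.intro algebra_product_axioms.intro
        nijenhuis_axioms.intro \<mu> assms(3))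
  have "eval_relation prod.scale box z P = 0" if "P \<in> set Rs" for P z
    using assms(1) that \<mu>(3) box_relation by blast
  then show ?thesis
    by (simp add: ns_algebra_def nonassoc_algebra_def in_category_def module_axioms
        prod.p.module_axioms bilinear_prec bilinear_succ bilinear_vee bilinear_box)
qed

end
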